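(* Let $E$ be a normed space, let $f\colon E\to E$, let $p\in(1,+\infty)$ and let $X\in\{c(E),l^\infty(E)\}$. Assume that the composition operator $C_f$ maps $bv_p(E)$ into $X$. Then $C_f\colon bv_p(E)\to X$ is continuous if and only if $f$ is a constant mapping.
   Context: $E$ is a normed space over $\mathbb R$ or $\mathbb C$ with norm $\|\cdot\|$. For a map $f\colon E\to E$, the composition operator $C_f$ assigns to a sequence $x\colon\mathbb N\to E$ the sequence $C_f(x)$ with $C_f(x)(n)=f(x(n))$ for all $n\in\mathbb N$. $l^\infty(E)$ is the space of bounded $E$-valued sequences and $c(E)$ its subspace of convergent sequences, both with norm $\|x\|_\infty=\sup_n\|x(n)\|$. $bv_p(E)$ is the space of all sequences $x\colon\mathbb N\to E$ with $\sum_{n=1}^\infty\|x(n+1)-x(n)\|^p<+\infty$, with norm $\|x\|_{bv_p}=\|x(1)\|+\bigl(\sum_{n=1}^\infty\|x(n+1)-x(n)\|^p\bigr)^{1/p}$. *)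

theory Defs
  imports "HOL-Analysis.Analysis"
begin

text \<open>
  A normed space is a type of class \<^class>\<open>real_normed_vector\<close>. A complex normed space is such a type
  after restriction of scalars; the scalar field plays no further role. Sequences are functions on
  \<^typ>\<open>nat\<close>, so their first term is the one with index \<open>0\<close>.
\<close>

definition comp_op :: "('a \<Rightarrow> 'a) \<Rightarrow> (nat \<Rightarrow> 'a) \<Rightarrow> nat \<Rightarrow> 'a"
  where "comp_op f x = (\<lambda>n. f (x n))"

definition l_inf :: "(nat \<Rightarrow> 'a::real_normed_vector) set"
  where "l_inf = {x. bounded (range x)}"

definition c_seq :: "(nat \<Rightarrow> 'a::real_normed_vector) set"
  where "c_seq = {x. convergent x}"

definition sup_norm :: "(nat \<Rightarrow> 'a::real_normed_vector) \<Rightarrow> real"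
  where "sup_norm x = (SUP n. norm (x n))"

definition bv :: "real \<Rightarrow> (nat \<Rightarrow> 'a::real_normed_vector) set"
  where "bv p = {x. summable (\<lambda>n. norm (x (Suc n) - x n) powr p)}"

definition bv_norm :: "real \<Rightarrow> (nat \<Rightarrow> 'a::real_normed_vector) \<Rightarrow> real"
  where "bv_norm p x = norm (x 0) + (\<Sum>n. norm (x (Suc n) - x n) powr p) powr (1 / p)"

text \<open>
  The topology induced by a norm \<open>N\<close> on a space \<open>V\<close> of sequences. \<^const>\<open>Metric_space\<close> asks for a
  nonnegative distance also outside the carrier, where \<open>N\<close> may be meaningless; hence the guard.
\<close>

definition norm_dist ::
    "(nat \<Rightarrow> 'a::real_normed_vector) set \<Rightarrow> ((nat \<Rightarrow> 'a) \<Rightarrow> real) \<Rightarrow> (nat \<Rightarrow> 'a) \<Rightarrow> (nat \<Rightarrow> 'a) \<Rightarrow> real"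
  where "norm_dist V N x y = (if x \<in> V \<and> y \<in> V then N (\<lambda>n. x n - y n) else 0)"

definition norm_topology ::
    "(nat \<Rightarrow> 'a::real_normed_vector) set \<Rightarrow> ((nat \<Rightarrow> 'a) \<Rightarrow> real) \<Rightarrow> (nat \<Rightarrow> 'a) topology"
  where "norm_topology V N = Metric_space.mtopology V (norm_dist V N)"

text \<open>The distances so obtained are metrics, so these topologies are the intended ones.\<close>

lemma Metric_space_norm_dist:
  fixes V :: "(nat \<Rightarrow> 'a::real_normed_vector) set"
  assumes diff: "\<And>x y. \<lbrakk>x \<in> V; y \<in> V\<rbrakk> \<Longrightarrow> (\<lambda>n. x n - y n) \<in> V"
    and nonneg: "\<And>x. x \<in> V \<Longrightarrow> 0 \<le> N x"
    and zero: "\<And>x. x \<in> V \<Longrightarrow> N x = 0 \<longleftrightarrow> x = (\<lambda>_. 0)"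
    and minus: "\<And>x. N (\<lambda>n. - x n) = N x"
    and add: "\<And>x y. \<lbrakk>x \<in> V; y \<in> V\<rbrakk> \<Longrightarrow> N (\<lambda>n. x n + y n) \<le> N x + N y"
  shows "Metric_space V (norm_dist V N)"
proof
  fix x y
  show "0 \<le> norm_dist V N x y"
    by (simp add: norm_dist_def diff nonneg)
  show "norm_dist V N x y = norm_dist V N y x"
    using minus[of "\<lambda>n. x n - y n"] by (simp add: norm_dist_def)
next
  fix x y assume "x \<in> V" "y \<in> V"
  then show "norm_dist V N x y = 0 \<longleftrightarrow> x = y"
    by (simp add: norm_dist_def diff zero fun_eq_iff)
next
  fix x y z assume "x \<in> V" "y \<in> V" "z \<in> V"
  then show "norm_dist V N x z \<le> norm_dist V N x y + norm_dist V N y z"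
    using add[OF diff[of x y] diff[of y z]] by (simp add: norm_dist_def)
qed

lemma c_seq_subset_l_inf: "c_seq \<subseteq> l_inf"
  by (auto simp: c_seq_def l_inf_def convergent_def convergent_imp_bounded)

lemma l_inf_bdd_above: "x \<in> l_inf \<Longrightarrow> bdd_above (range (\<lambda>n. norm (x n)))"
  by (auto simp: l_inf_def bounded_iff bdd_above_def)

lemma norm_le_sup_norm: "x \<in> l_inf \<Longrightarrow> norm (x n) \<le> sup_norm x"
  unfolding sup_norm_def by (rule cSUP_upper[OF _ l_inf_bdd_above]) auto

lemma Metric_space_sup_norm:
  fixes V :: "(nat \<Rightarrow> 'a::real_normed_vector) set"
  assumes V: "V \<subseteq> l_inf" and diff: "\<And>x y. \<lbrakk>x \<in> V; y \<in> V\<rbrakk> \<Longrightarrow> (\<lambda>n. x n - y n) \<in> V"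
  shows "Metric_space V (norm_dist V sup_norm)"
proof (rule Metric_space_norm_dist)
  fix x y assume x: "x \<in> V"
  have le: "norm (x n) \<le> sup_norm x" for n
    using x V by (blast intro: norm_le_sup_norm)
  show "0 \<le> sup_norm x"
    using le[of 0] norm_ge_zero order_trans by blast
  show "sup_norm x = 0 \<longleftrightarrow> x = (\<lambda>_. 0)"
    using le by (auto simp: sup_norm_def fun_eq_iff)
  assume y: "y \<in> V"
  have le': "norm (y n) \<le> sup_norm y" for n
    using y V by (blast intro: norm_le_sup_norm)
  show "sup_norm (\<lambda>n. x n + y n) \<le> sup_norm x + sup_norm y"
    unfolding sup_norm_def[of "\<lambda>n. x n + y n"]
    by (rule cSUP_least) (auto intro: norm_triangle_le add_mono le le')
qed (auto simp: diff sup_norm_def)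

lemma Metric_space_l_inf: "Metric_space l_inf (norm_dist l_inf sup_norm)"
  by (rule Metric_space_sup_norm) (auto simp: l_inf_def bounded_minus_comp)

lemma Metric_space_c_seq: "Metric_space c_seq (norm_dist c_seq sup_norm)"
  by (rule Metric_space_sup_norm[OF c_seq_subset_l_inf]) (auto simp: c_seq_def convergent_diff)

lemma powr_convex_ineq:
  fixes x y u v p :: real
  assumes p: "1 \<le> p" and x: "0 \<le> x" and y: "0 \<le> y" and u: "0 \<le> u" and v: "0 \<le> v" and uv: "u + v = 1"
  shows "(u * x + v * y) powr p \<le> u * x powr p + v * y powr p"
proof -
  have le: "(w * z) powr p \<le> w * z powr p" if "0 \<le> w" "w \<le> 1" "0 \<le> z" for w z :: real
  proof (cases "w = 0")
    case False
    then have "w powr p \<le> w powr 1"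
      using that p by (intro powr_mono') auto
    then show ?thesis using that False by (simp add: powr_mult mult_right_mono)
  qed simp
  consider "x = 0" | "y = 0" | "0 < x" "0 < y" using x y by linarith
  then show ?thesis
  proof cases
    case 3
    then show ?thesis
      using powr_convex[OF p] u v uv by (auto simp: convex_on_def)
  qed (use le[of v y] le[of u x] x y u v uv in auto)
qed

lemma minkowski_series:
  fixes a b :: "nat \<Rightarrow> real"
  assumes p: "1 \<le> p" and a: "\<And>n. 0 \<le> a n" and b: "\<And>n. 0 \<le> b n"
    and sa: "summable (\<lambda>n. a n powr p)" and sb: "summable (\<lambda>n. b n powr p)"
  shows "summable (\<lambda>n. (a n + b n) powr p)" (is ?S)
    and "(\<Sum>n. (a n + b n) powr p) powr (1 / p)
      \<le> (\<Sum>n. a n powr p) powr (1 / p) + (\<Sum>n. b n powr p) powr (1 / p)" (is ?I)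
proof -
  define A where "A = (\<Sum>n. a n powr p) powr (1 / p)"
  define B where "B = (\<Sum>n. b n powr p) powr (1 / p)"
  have A0: "0 \<le> A" and B0: "0 \<le> B" by (auto simp: A_def B_def)
  have Ap: "A powr p = (\<Sum>n. a n powr p)" and Bp: "B powr p = (\<Sum>n. b n powr p)"
    using p by (auto simp: A_def B_def powr_powr suminf_nonneg sa sb)
  have key: "?S \<and> (\<Sum>n. (a n + b n) powr p) \<le> (S + T) powr p"
    if S: "A \<le> S" "0 < S" and T: "B \<le> T" "0 < T" for S T
  proof -
    define c where "c n = S / (S + T) * (a n / S) powr p + T / (S + T) * (b n / T) powr p" for n
    have c_eq: "c n = S / (S + T) * (a n powr p / S powr p) + T / (S + T) * (b n powr p / T powr p)" for n
      using S T a b by (simp add: c_def powr_divide)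
    have c: "((a n + b n) / (S + T)) powr p \<le> c n" for n
      using powr_convex_ineq[OF p, of "a n / S" "b n / T" "S / (S + T)" "T / (S + T)"] S T a b
      by (simp add: c_def add_divide_distrib[symmetric])
    have c': "(a n + b n) powr p \<le> (S + T) powr p * c n" for n
      using c[of n] S T a[of n] b[of n] by (simp add: powr_divide field_simps)
    have sc: "summable c"
      unfolding c_eq by (intro summable_add summable_mult summable_divide sa sb)
    have sS: ?S
      by (rule summable_comparison_test'[OF summable_mult[OF sc, of "(S + T) powr p"]])
        (simp add: c')
    have "suminf c = S / (S + T) * (A powr p / S powr p) + T / (S + T) * (B powr p / T powr p)"
      unfolding c_eq Ap Bp
      by (simp add: suminf_add[symmetric] suminf_mult suminf_divide summable_mult summable_divide sa sb)
    also have "\<dots> \<le> S / (S + T) * 1 + T / (S + T) * 1"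
      using S T A0 B0 p by (intro add_mono mult_left_mono) (auto simp: divide_le_eq powr_mono2)
    also have "\<dots> = 1"
      using S T by (simp add: add_divide_distrib[symmetric])
    finally have "suminf c \<le> 1" .
    have "(\<Sum>n. (a n + b n) powr p) \<le> (\<Sum>n. (S + T) powr p * c n)"
      by (intro suminf_le c' sS summable_mult sc)
    also have "\<dots> = (S + T) powr p * suminf c"
      by (rule suminf_mult[OF sc])
    also have "\<dots> \<le> (S + T) powr p"
      using \<open>suminf c \<le> 1\<close> by (simp add: mult_left_le)
    finally show ?thesis using sS by simp
  qed
  show S: ?S using key[of "A + 1" "B + 1"] A0 B0 by simp
  have "(\<Sum>n. (a n + b n) powr p) powr (1 / p) \<le> A + B + e" if "0 < e" for e
  proof -
    have "(\<Sum>n. (a n + b n) powr p) \<le> (A + B + e) powr p"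
      using key[of "A + e / 2" "B + e / 2"] A0 B0 that by (simp add: algebra_simps)
    then have "(\<Sum>n. (a n + b n) powr p) powr (1 / p) \<le> ((A + B + e) powr p) powr (1 / p)"
      using p by (intro powr_mono2) (auto intro: suminf_nonneg S)
    then show ?thesis using p A0 B0 that by (simp add: powr_powr)
  qed
  then show ?I unfolding A_def[symmetric] B_def[symmetric] by (rule field_le_epsilon)
qed

lemma bv_add:
  fixes x y :: "nat \<Rightarrow> 'a::real_normed_vector"
  assumes p: "1 \<le> p" and x: "x \<in> bv p" and y: "y \<in> bv p"
  shows "(\<lambda>n. x n + y n) \<in> bv p" (is ?S)
    and "bv_norm p (\<lambda>n. x n + y n) \<le> bv_norm p x + bv_norm p y" (is ?I)
proof -
  let ?a = "\<lambda>n. norm (x (Suc n) - x n)" and ?b = "\<lambda>n. norm (y (Suc n) - y n)"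
  let ?c = "\<lambda>n. norm (x (Suc n) + y (Suc n) - (x n + y n))"
  have sa: "summable (\<lambda>n. ?a n powr p)" and sb: "summable (\<lambda>n. ?b n powr p)"
    using x y by (auto simp: bv_def)
  note M = minkowski_series[OF p norm_ge_zero norm_ge_zero sa sb]
  have le: "?c n powr p \<le> (?a n + ?b n) powr p" for n
    using p norm_triangle_ineq[of "x (Suc n) - x n" "y (Suc n) - y n"]
    by (intro powr_mono2) (auto simp: algebra_simps)
  have sc: "summable (\<lambda>n. ?c n powr p)"
    by (rule summable_comparison_test'[OF M(1)]) (simp add: le)
  then show ?S by (simp add: bv_def)
  have "(\<Sum>n. ?c n powr p) powr (1 / p) \<le> (\<Sum>n. (?a n + ?b n) powr p) powr (1 / p)"
    using p by (intro powr_mono2 suminf_le le sc M(1) suminf_nonneg) auto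
  then show ?I
    using M(2) norm_triangle_ineq[of "x 0" "y 0"] by (simp add: bv_norm_def)
qed

lemma Metric_space_bv:
  assumes p: "1 \<le> p"
  shows "Metric_space (bv p) (norm_dist (bv p) (bv_norm p))"
proof (rule Metric_space_norm_dist)
  have minus: "norm (- x (Suc n) - - x n) = norm (x (Suc n) - x n)" for x :: "nat \<Rightarrow> 'a" and n
    by (metis minus_diff_minus norm_minus_cancel)
  show "bv_norm p (\<lambda>n. - x n) = bv_norm p x" for x :: "nat \<Rightarrow> 'a"
    unfolding bv_norm_def minus by simp
  fix x y :: "nat \<Rightarrow> 'a" assume x: "x \<in> bv p"
  have s: "summable (\<lambda>n. norm (x (Suc n) - x n) powr p)" using x by (simp add: bv_def)
  show "0 \<le> bv_norm p x" by (simp add: bv_norm_def)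
  show "bv_norm p x = 0 \<longleftrightarrow> x = (\<lambda>_. 0)"
  proof
    assume "bv_norm p x = 0"
    then have x0: "x 0 = 0" and "(\<Sum>n. norm (x (Suc n) - x n) powr p) = 0"
      by (auto simp: bv_norm_def add_nonneg_eq_0_iff)
    then have "x (Suc n) = x n" for n
      using suminf_eq_zero_iff[OF s] by simp
    then have "x n = 0" for n using x0 by (induction n) auto
    then show "x = (\<lambda>_. 0)" by auto
  qed (simp add: bv_norm_def)
  assume y: "y \<in> bv p"
  show "bv_norm p (\<lambda>n. x n + y n) \<le> bv_norm p x + bv_norm p y"
    by (rule bv_add(2)[OF p x y])
  have "(\<lambda>n. - y n) \<in> bv p"
    using y unfolding bv_def mem_Collect_eq minus .
  from bv_add(1)[OF p x this] show "(\<lambda>n. x n - y n) \<in> bv p" by simp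
qed

end

theory Submission
  imports Defs
begin

text \<open>
  Since \<open>p > 1\<close>, the ramp from \<open>0\<close> to \<open>w\<close> in \<open>N\<close> equal steps has \<open>bv\<^sub>p\<close>-norm
  \<open>(N * (norm w / N) powr p) powr (1 / p)\<close>, which tends to \<open>0\<close> as \<open>N\<close> grows although the ramp ends
  at \<open>w\<close>. So continuity of \<open>C\<^sub>f\<close> at the zero sequence alone forces \<open>f w = f 0\<close> for every \<open>w\<close>.
\<close>

text \<open>The \<open>min\<close> freezes the sequence at \<open>w\<close> from index
  \<open>N\<close> on, so only finitely many increments are nonzero. For \<open>N = 0\<close>
  division by zero yields the zero sequence, which never reaches \<open>w\<close>.\<close>

definition ramp :: "nat \<Rightarrow> 'a::real_normed_vector \<Rightarrow> nat \<Rightarrow> 'a"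
  where "ramp N w n = (real (min n N) / real N) *\<^sub>R w"

lemma ramp_0 [simp]: "ramp N w 0 = 0"
  by (simp add: ramp_def)

lemma ramp_end: "0 < N \<Longrightarrow> ramp N w N = w"
  by (simp add: ramp_def)

lemma norm_ramp_step:
  "norm (ramp N w (Suc n) - ramp N w n) = (if n < N then norm w / real N else 0)"
  by (auto simp: ramp_def min_def scaleR_diff_left[symmetric] diff_divide_distrib[symmetric])

lemma ramp_sums:
  "(\<lambda>n. norm (ramp N w (Suc n) - ramp N w n) powr p) sums (real N * (norm w / real N) powr p)"
proof -
  have "(\<lambda>n. norm (ramp N w (Suc n) - ramp N w n) powr p)
      sums (\<Sum>n<N. norm (ramp N w (Suc n) - ramp N w n) powr p)"
    by (rule sums_finite) (auto simp: norm_ramp_step)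
  then show ?thesis
    by (simp add: norm_ramp_step)
qed

lemma ramp_in_bv: "ramp N w \<in> bv p"
  using ramp_sums by (auto simp: bv_def dest: sums_summable)

lemma bv_norm_ramp: "bv_norm p (ramp N w) = (real N * (norm w / real N) powr p) powr (1 / p)"
  by (simp add: bv_norm_def sums_unique[OF ramp_sums, symmetric])

text \<open>The norm equals \<open>norm w * real N powr (1 / p - 1)\<close>, and this exponent is
  negative because \<open>1 < p\<close>.\<close>

lemma bv_norm_ramp_tendsto_0:
  assumes "1 < p"
  shows "(\<lambda>N. bv_norm p (ramp N w)) \<longlonglongrightarrow> 0"
proof -
  have "(\<lambda>N. norm w * real N powr (1 / p - 1)) \<longlonglongrightarrow> norm w * 0"
    using assms
    by (intro tendsto_mult tendsto_const tendsto_neg_powr filterlim_real_sequentially) auto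
  \<comment> \<open>This includes \<open>N = 0\<close>, where both sides vanish because
    \<open>0 powr _ = 0\<close>.\<close>
  moreover have "bv_norm p (ramp N w) = norm w * real N powr (1 / p - 1)" for N
    using assms
    by (simp add: bv_norm_ramp powr_mult powr_divide powr_powr powr_diff)
  ultimately show ?thesis by simp
qed

lemma zero_in_bv: "(\<lambda>_. 0) \<in> bv p"
  by (simp add: bv_def)

text \<open>A general \<open>X\<close> treats both target spaces at once: differences stay in
  \<open>X\<close> and hence are bounded, so the sup norm controls each single term.\<close>

lemma continuous_comp_op_imp_constant:
  fixes f :: "'a::real_normed_vector \<Rightarrow> 'a"
  assumes p: "1 < p" and X: "X \<subseteq> l_inf" "Metric_space X (norm_dist X sup_norm)"
    and diff: "\<And>x y. \<lbrakk>x \<in> X; y \<in> X\<rbrakk> \<Longrightarrow> (\<lambda>n. x n - y n) \<in> X"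
    and maps: "comp_op f \<in> bv p \<rightarrow> X"
    and cont: "continuous_map (norm_topology (bv p) (bv_norm p)) (norm_topology X sup_norm) (comp_op f)"
  shows "f w = f 0"
proof -
  have bv: "Metric_space (bv p) (norm_dist (bv p) (bv_norm p) :: (nat \<Rightarrow> 'a) \<Rightarrow> _)"
    using p by (intro Metric_space_bv) simp
  have "dist (f 0) (f w) \<le> 0 + e" if "0 < e" for e
  proof -
    have "\<exists>\<delta>>0. \<forall>y. y \<in> bv p \<and> norm_dist (bv p) (bv_norm p) (\<lambda>_. 0) y < \<delta>
        \<longrightarrow> norm_dist X sup_norm (comp_op f (\<lambda>_. 0)) (comp_op f y) < e"
      using Metric_space.metric_continuous_map[OF bv X(2), THEN iffD1,
          OF cont[unfolded norm_topology_def], THEN conjunct2, rule_format, OF zero_in_bv that] .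
    then obtain \<delta> where "0 < \<delta>" and
      \<delta>': "\<And>y. \<lbrakk>y \<in> bv p; norm_dist (bv p) (bv_norm p) (\<lambda>_. 0) y < \<delta>\<rbrakk>
        \<Longrightarrow> norm_dist X sup_norm (comp_op f (\<lambda>_. 0)) (comp_op f y) < e"
      by blast
    \<comment> \<open>Symmetry of both metrics moves the zero sequence to the second argument, so
      that the difference in the domain is \<open>y\<close> itself and not its negative.\<close>
    have \<delta>: "norm_dist X sup_norm (comp_op f y) (comp_op f (\<lambda>_. 0)) < e"
      if "y \<in> bv p" "bv_norm p y < \<delta>" for y
    proof -
      have "norm_dist (bv p) (bv_norm p) (\<lambda>_. 0) y = bv_norm p y"
        unfolding Metric_space.commute[OF bv, of "\<lambda>_. 0" y]
        using that(1) by (simp add: norm_dist_def zero_in_bv)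
      with \<delta>'[OF that(1)] that(2) show ?thesis
        by (simp add: Metric_space.commute[OF X(2), of "comp_op f y"])
    qed
    have "\<forall>\<^sub>F N in sequentially. bv_norm p (ramp N w) < \<delta> \<and> 0 < N"
      using order_tendstoD(2)[OF bv_norm_ramp_tendsto_0[OF p] \<open>0 < \<delta>\<close>] eventually_gt_at_top[of 0]
      by (rule eventually_conj)
    then obtain N where N: "bv_norm p (ramp N w) < \<delta>" "0 < N"
      using eventually_happens'[OF sequentially_bot] by blast
    have inX: "comp_op f (ramp N w) \<in> X" "comp_op f (\<lambda>_. 0) \<in> X"
      using maps ramp_in_bv zero_in_bv by blast+
    \<comment> \<open>The supremum is compared with its term at index \<open>N\<close>, where the
      ramp has arrived at \<open>w\<close>.\<close>
    have "norm (f (ramp N w N) - f 0) \<le> sup_norm (\<lambda>n. comp_op f (ramp N w) n - comp_op f (\<lambda>_. 0) n)"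
      using norm_le_sup_norm[of "\<lambda>n. comp_op f (ramp N w) n - comp_op f (\<lambda>_. 0) n" N] diff[OF inX] X(1)
      by (auto simp: comp_op_def)
    also have "\<dots> < e"
      using \<delta>[OF ramp_in_bv N(1)] inX by (simp add: norm_dist_def)
    finally show ?thesis
      using N(2) by (simp add: ramp_end dist_norm norm_minus_commute)
  qed
  then have "dist (f 0) (f w) \<le> 0" by (rule field_le_epsilon)
  then show ?thesis by simp
qed

theorem theorem14:
  fixes f :: "'a::real_normed_vector \<Rightarrow> 'a"
    and p :: real
    and X :: "(nat \<Rightarrow> 'a) set"
  assumes "1 < p"
    and "X \<in> {c_seq, l_inf}"
    and "comp_op f \<in> bv p \<rightarrow> X"
  shows "continuous_map (norm_topology (bv p) (bv_norm p)) (norm_topology X sup_norm) (comp_op f)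
    \<longleftrightarrow> f constant_on UNIV"
proof -
  have X: "X \<subseteq> l_inf" "Metric_space X (norm_dist X sup_norm)"
    using assms(2) Metric_space_c_seq Metric_space_l_inf c_seq_subset_l_inf by auto
  show ?thesis
  proof
    assume cont: "continuous_map (norm_topology (bv p) (bv_norm p)) (norm_topology X sup_norm) (comp_op f)"
    have "(\<lambda>n. x n - y n) \<in> X" if "x \<in> X" "y \<in> X" for x y
      using assms(2) that by (auto simp: c_seq_def l_inf_def convergent_diff bounded_minus_comp)
    from continuous_comp_op_imp_constant[OF assms(1) X this assms(3) cont]
    show "f constant_on UNIV" unfolding constant_on_def by blast
  next
    assume "f constant_on UNIV"
    then obtain c where c: "comp_op f = (\<lambda>_ _. c)"
      by (auto simp: constant_on_def comp_op_def fun_eq_iff)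
    \<comment> \<open>This sequence is the image of the zero sequence, so the mapping hypothesis
      puts it into \<open>X\<close> for either choice. Then \<open>comp_op f\<close> is a constant
      map with value in the target space.\<close>
    then have "(\<lambda>_. c) \<in> X"
      using assms(3) zero_in_bv by force
    with c show "continuous_map (norm_topology (bv p) (bv_norm p)) (norm_topology X sup_norm) (comp_op f)"
      by (simp add: norm_topology_def Metric_space.topspace_mtopology[OF X(2)])
  qed
qed

end
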